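(* Let $A$ be an associative and commutative ring with unit, let $n\geq 6$ be an integer and let $\Gamma = EL_n(A)$. Suppose that: (1) $EL_2(A) = SL_2(A)$; (2) there is a constant $M\in\mathbb{N}$ such that every element of $\Gamma$ can be written as a product $x_1x_2\cdots x_M$ where each $x_m$ lies either in $G=SL_2(A)$ (embedded in $\Gamma$ as the upper-left $2\times 2$ block, i.e. $g\mapsto \begin{pmatrix} g & 0\\ 0 & I_{n-2}\end{pmatrix}$) or in the set of single commutators $\{aba^{-1}b^{-1} : a,b\in\Gamma\}$ of $\Gamma$. Then every quasi-homomorphism $\psi\colon\Gamma\to\mathbb{R}$ is bounded. Equivalently, the stable commutator length vanishes identically on $[\Gamma,\Gamma]$.
   Context: For an associative ring $B$ with unit, an elementary matrix in $M_n(B)$ is a matrix whose diagonal entries are $1$ and all of whose off-diagonal entries except at most one are $0$; $EL_n(B)$ is the group generated by all elementary matrices in $M_n(B)$. $SL_n(A)$ is the group of matrices in $M_n(A)$ of determinant $1$. A quasi-homomorphism on a group $\Gamma$ is a function $\psi\colon\Gamma\to\mathbb{R}$ with $\sup_{g,h\in\Gamma}|\psi(gh)-\psi(g)-\psi(h)|<\infty$. For $g\in[\Gamma,\Gamma]$, $\mathrm{cl}(g)$ is the least number of commutators whose product is $g$ ($\mathrm{cl}(e)=0$), and the stable commutator length is $\mathrm{scl}(g)=\lim_{k\to\infty}\mathrm{cl}(g^k)/k$. *)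

theory Defs
  imports Main "HOL.Real"
begin

text \<open>n x n matrices over a ring are represented as functions nat => nat => 'a;
  only the entries with indices < n are relevant, and all matrices that we
  form are zero outside the block {0..<n} x {0..<n}.\<close>

type_synonym 'a mat = "nat \<Rightarrow> nat \<Rightarrow> 'a"

definition mmul :: "nat \<Rightarrow> 'a::comm_ring_1 mat \<Rightarrow> 'a mat \<Rightarrow> 'a mat" where
  "mmul n X Y = (\<lambda>i j. if i < n \<and> j < n then (\<Sum>k<n. X i k * Y k j) else 0)"

definition mid :: "nat \<Rightarrow> 'a::comm_ring_1 mat" where
  "mid n = (\<lambda>i j. if i = j \<and> i < n then 1 else 0)"

definition elem_mat :: "nat \<Rightarrow> nat \<Rightarrow> nat \<Rightarrow> 'a::comm_ring_1 \<Rightarrow> 'a mat" where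
  "elem_mat n p q c = (\<lambda>i j. if i = p \<and> j = q then c else mid n i j)"

definition elementary :: "nat \<Rightarrow> 'a::comm_ring_1 mat set" where
  "elementary n = {elem_mat n p q c | p q c. p < n \<and> q < n \<and> p \<noteq> q}"

text \<open>EL_n: the group generated by elementary matrices.  Since the inverse of
  an elementary matrix is elementary, this is the submonoid generated by them.\<close>
inductive_set EL :: "nat \<Rightarrow> 'a::comm_ring_1 mat set" for n where
  EL_id: "mid n \<in> EL n"
| EL_step: "e \<in> elementary n \<Longrightarrow> g \<in> EL n \<Longrightarrow> mmul n e g \<in> EL n"

definition det2 :: "'a::comm_ring_1 mat \<Rightarrow> 'a" where
  "det2 g = g 0 0 * g 1 1 - g 0 1 * g 1 0"

definition SL2 :: "'a::comm_ring_1 mat set" where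
  "SL2 = {g. det2 g = 1 \<and> (\<forall>i j. (2 \<le> i \<or> 2 \<le> j) \<longrightarrow> g i j = 0)}"

definition embed2 :: "nat \<Rightarrow> 'a::comm_ring_1 mat \<Rightarrow> 'a mat" where
  "embed2 n g = (\<lambda>i j. if i < 2 \<and> j < 2 then g i j else mid n i j)"

definition is_inverse :: "nat \<Rightarrow> 'a::comm_ring_1 mat \<Rightarrow> 'a mat \<Rightarrow> bool" where
  "is_inverse n a a' \<longleftrightarrow> mmul n a a' = mid n \<and> mmul n a' a = mid n"

definition commutators :: "nat \<Rightarrow> 'a::comm_ring_1 mat set \<Rightarrow> 'a mat set" where
  "commutators n \<Gamma> = {mmul n (mmul n (mmul n a b) a') b' | a b a' b'.
      a \<in> \<Gamma> \<and> b \<in> \<Gamma> \<and> is_inverse n a a' \<and> is_inverse n b b'}"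

definition mprod :: "nat \<Rightarrow> 'a::comm_ring_1 mat list \<Rightarrow> 'a mat" where
  "mprod n xs = foldr (mmul n) xs (mid n)"

definition quasi_hom :: "nat \<Rightarrow> 'a::comm_ring_1 mat set \<Rightarrow> ('a mat \<Rightarrow> real) \<Rightarrow> bool" where
  "quasi_hom n \<Gamma> \<psi> \<longleftrightarrow>
     (\<exists>D. \<forall>g\<in>\<Gamma>. \<forall>h\<in>\<Gamma>. \<bar>\<psi> (mmul n g h) - \<psi> g - \<psi> h\<bar> \<le> D)"

end

(* Pull \<psi> back to EL_4 and let \<phi> be its homogenization. A homogeneous quasi-homomorphism is
   conjugation invariant and ignores unipotent radicals, so on a block triangular matrix with
   diagonal blocks g, h in SL_2 it takes the value \<phi>(g) + \<phi>(h).
   For g in SL_2 and an elementary s, the matrix [[gs, 1], [0, g^-1]] is conjugate to the block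
   companion matrix of the matrix polynomial X^2 - (gs + g^-1) X + s. As s - 1 has rank one, this
   polynomial is a scalar polynomial plus a rank one term, so the companion matrix is in turn
   conjugate to a block triangular matrix whose diagonal blocks are companion matrices of
   X^2 - tr(g) X + 1 and X^2 - tr(gs) X + 1. A 2 x 2 companion matrix is conjugate to its inverse,
   so \<phi> kills it. Hence \<phi>(gs) = \<phi>(g), and \<phi> vanishes on EL_2 = SL_2.
   So \<psi> is bounded on SL_2; it is bounded on commutators in any case. *)

theory Submission
  imports Defs Complex_Main "HOL-Algebra.Group"
begin

section \<open>Quasi-homomorphisms on an abstract group and their homogenization\<close>

locale quasimorphism = group G for G (structure) +
  fixes \<phi> :: "'a \<Rightarrow> real" and D :: real
  assumes quasi: "\<lbrakk>x \<in> carrier G; y \<in> carrier G\<rbrakk> \<Longrightarrow> \<bar>\<phi> (x \<otimes> y) - \<phi> x - \<phi> y\<bar> \<le> D"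

locale homogeneous_quasimorphism = quasimorphism +
  assumes homogeneous: "x \<in> carrier G \<Longrightarrow> \<phi> (x [^] (k::nat)) = of_nat k * \<phi> x"

context quasimorphism
begin

lemma defect_nonneg: "0 \<le> D"
  using quasi[OF one_closed one_closed] by linarith

text \<open>Each multiplication costs one defect, hence \<open>m\<close> defects for
  \<open>Suc m\<close> factors. The empty power is left out because it would contribute the value at
  the identity.\<close>

lemma quasi_pow:
  assumes "x \<in> carrier G"
  shows "\<bar>\<phi> (x [^] Suc m) - of_nat (Suc m) * \<phi> x\<bar> \<le> of_nat m * D"
proof (induction m)
  case 0
  then show ?case using assms by simp
next
  case (Suc m)
  have "\<bar>\<phi> (x [^] Suc m \<otimes> x) - \<phi> (x [^] Suc m) - \<phi> x\<bar> \<le> D"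
    using assms by (intro quasi) auto
  then show ?case using Suc by (auto simp: algebra_simps)
qed

lemma quasi_pow_average:
  assumes "x \<in> carrier G" "0 < k"
  shows "\<bar>\<phi> (x [^] k) / of_nat k - \<phi> x\<bar> \<le> D"
proof -
  obtain m where k: "k = Suc m" using assms(2) gr0_implies_Suc by blast
  have "\<bar>\<phi> (x [^] k) - of_nat k * \<phi> x\<bar> \<le> of_nat k * D"
    using quasi_pow[OF assms(1), of m] defect_nonneg unfolding k by (simp add: algebra_simps)
  moreover have "\<phi> (x [^] k) / of_nat k - \<phi> x = (\<phi> (x [^] k) - of_nat k * \<phi> x) / of_nat k"
    using assms(2) by (simp add: field_simps)
  ultimately show ?thesis
    using assms(2) by (simp add: abs_divide divide_le_eq mult.commute)
qed

lemma pow_average_dist: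
  assumes "x \<in> carrier G" "0 < k" "0 < m"
  shows "\<bar>\<phi> (x [^] (k * m)) / of_nat (k * m) - \<phi> (x [^] k) / of_nat k\<bar> \<le> D / of_nat k"
proof -
  have "\<bar>\<phi> ((x [^] k) [^] m) / of_nat m - \<phi> (x [^] k)\<bar> \<le> D"
    using assms by (intro quasi_pow_average) auto
  then have "\<bar>\<phi> (x [^] (k * m)) / of_nat m - \<phi> (x [^] k)\<bar> / of_nat k \<le> D / of_nat k"
    using assms by (intro divide_right_mono) (auto simp: nat_pow_pow)
  moreover have "\<phi> (x [^] (k * m)) / of_nat (k * m) - \<phi> (x [^] k) / of_nat k
      = (\<phi> (x [^] (k * m)) / of_nat m - \<phi> (x [^] k)) / of_nat k"
    by (simp add: diff_divide_distrib mult.commute)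
  ultimately show ?thesis by (simp add: abs_divide)
qed

lemma pow_average_convergent:
  assumes x: "x \<in> carrier G"
  shows "convergent (\<lambda>k. \<phi> (x [^] k) / of_nat k)"
proof -
  let ?b = "\<lambda>k. \<phi> (x [^] k) / real k"
  \<comment> \<open>Both averages are compared with the one at the common multiple
    \<open>k * m\<close>.\<close>
  have close: "\<bar>?b k - ?b m\<bar> \<le> D / real k + D / real m" if "0 < k" "0 < m" for k m
  proof -
    have "\<bar>?b (k * m) - ?b k\<bar> \<le> D / real k" "\<bar>?b (k * m) - ?b m\<bar> \<le> D / real m"
      using pow_average_dist[OF x that] pow_average_dist[OF x that(2,1)] by (simp_all add: mult.commute)
    then show ?thesis by linarith
  qed
  have "Cauchy ?b"
  proof (rule metric_CauchyI)
    fix e :: real assume e: "0 < e"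
    \<comment> \<open>Beyond \<open>2 * D / e\<close> each of the two error terms is below
      \<open>e / 2\<close>; starting at \<open>Suc N\<close> keeps the indices positive.\<close>
    obtain N where N: "2 * D / e < real N" using reals_Archimedean2 by blast
    have small: "D / real k < e / 2" if "Suc N \<le> k" for k
    proof -
      have "2 * D / e < real k" using N that by linarith
      then have "2 * D < real k * e" using e by (simp add: divide_less_eq)
      then show ?thesis using that by (simp add: field_simps)
    qed
    show "\<exists>M. \<forall>m\<ge>M. \<forall>k\<ge>M. dist (?b m) (?b k) < e"
    proof (intro exI allI impI)
      fix m k assume mk: "Suc N \<le> m" "Suc N \<le> k"
      then show "dist (?b m) (?b k) < e"
        using close[of m k] small[OF mk(1)] small[OF mk(2)] unfolding dist_real_def by linarith
    qed
  qed
  then show ?thesis by (rule Cauchy_convergent)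
qed

text \<open>The limit of the averages stays within \<open>D\<close> of \<open>\<phi>\<close>.
  Replacing the three values in the defect inequality then raises the defect from \<open>D\<close>
  to at most \<open>4 * D\<close>.\<close>

lemma homogenization:
  obtains \<phi>' where "homogeneous_quasimorphism G \<phi>' (4 * D)"
    and "\<And>x. x \<in> carrier G \<Longrightarrow> \<bar>\<phi>' x - \<phi> x\<bar> \<le> D"
proof -
  define \<phi>' where "\<phi>' x = lim (\<lambda>k. \<phi> (x [^] k) / real k)" for x
  have lim: "(\<lambda>k. \<phi> (x [^] k) / real k) \<longlonglongrightarrow> \<phi>' x" if "x \<in> carrier G" for x
    unfolding \<phi>'_def using pow_average_convergent[OF that] by (rule convergent_LIMSEQ_iff[THEN iffD1])
  have near: "\<bar>\<phi>' x - \<phi> x\<bar> \<le> D" if x: "x \<in> carrier G" for x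
  proof (rule LIMSEQ_le_const2)
    show "(\<lambda>k. \<bar>\<phi> (x [^] k) / real k - \<phi> x\<bar>) \<longlonglongrightarrow> \<bar>\<phi>' x - \<phi> x\<bar>"
      by (intro tendsto_intros lim x)
    show "\<exists>N. \<forall>k\<ge>N. \<bar>\<phi> (x [^] k) / real k - \<phi> x\<bar> \<le> D"
      using quasi_pow_average[OF x] by (intro exI[of _ 1]) auto
  qed
  have "homogeneous_quasimorphism G \<phi>' (4 * D)"
  proof
    fix x y assume xy: "x \<in> carrier G" "y \<in> carrier G"
    then show "\<bar>\<phi>' (x \<otimes> y) - \<phi>' x - \<phi>' y\<bar> \<le> 4 * D"
      using quasi[OF xy] near[OF xy(1)] near[OF xy(2)] near[OF m_closed[OF xy]] by linarith
  next
    fix x and k :: nat assume x: "x \<in> carrier G"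
    show "\<phi>' (x [^] k) = real k * \<phi>' x"
    proof (cases "k = 0")
      \<comment> \<open>For \<open>k = 0\<close> the indices \<open>k * m\<close> do not form a
        subsequence, so the value at the identity is computed directly.\<close>
      case True
      have "(\<lambda>m. \<phi> \<one> / real m) \<longlonglongrightarrow> 0" by (rule lim_const_over_n)
      moreover have "(\<lambda>m. \<phi> \<one> / real m) \<longlonglongrightarrow> \<phi>' \<one>" using lim[OF one_closed] by simp
      ultimately have "\<phi>' \<one> = 0" using LIMSEQ_unique by blast
      then show ?thesis using True by simp
    next
      case False
      have "strict_mono (\<lambda>m. k * m)" using False by (simp add: strict_mono_def)
      from LIMSEQ_subseq_LIMSEQ[OF lim[OF x] this]
      have "(\<lambda>m. real k * (\<phi> (x [^] (k * m)) / real (k * m))) \<longlonglongrightarrow> real k * \<phi>' x"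
        unfolding o_def by (rule tendsto_mult_left)
      \<comment> \<open>At \<open>m = 0\<close> both sides are 0, since division by zero yields
        0.\<close>
      moreover have "(\<lambda>m. real k * (\<phi> (x [^] (k * m)) / real (k * m))) = (\<lambda>m. \<phi> ((x [^] k) [^] m) / real m)"
        using False x by (simp add: nat_pow_pow)
      ultimately show ?thesis
        using lim[of "x [^] k"] x LIMSEQ_unique nat_pow_closed by metis
    qed
  qed
  then show thesis using near that by blast
qed

end

section \<open>Rigidity of homogeneous quasi-homomorphisms\<close>

context homogeneous_quasimorphism
begin

text \<open>By homogeneity the bounded quantity is \<open>k\<close> times the distance from
  \<open>\<phi> x\<close> to \<open>c\<close>. The equalities below follow by exhibiting an error
  that does not grow with \<open>k\<close>.\<close>

lemma eq_of_bounded_on_powers: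
  assumes "x \<in> carrier G" and bound: "\<And>k. \<bar>\<phi> (x [^] k) - of_nat k * c\<bar> \<le> C"
  shows "\<phi> x = c"
proof (rule ccontr)
  assume "\<phi> x \<noteq> c"
  then have pos: "0 < \<bar>\<phi> x - c\<bar>" by simp
  obtain k where k: "C / \<bar>\<phi> x - c\<bar> < real k" using reals_Archimedean2 by blast
  have "real k * \<phi> x - real k * c = real k * (\<phi> x - c)" by (simp add: algebra_simps)
  then have "real k * \<bar>\<phi> x - c\<bar> \<le> C"
    using bound[of k] by (simp add: homogeneous[OF assms(1)] abs_mult)
  then show False using k pos by (simp add: divide_less_eq)
qed

lemma one_eq_0: "\<phi> \<one> = 0"
  using homogeneous[OF one_closed, of 0] by simp

text \<open>The relation passes to \<open>k\<close>-th powers, and \<open>\<phi> h\<close> cancels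
  at the price of two defects. Conjugacy is stated as \<open>h x = y h\<close> so that no inverse
  has to be computed in applications.\<close>

lemma conj_eq:
  assumes "x \<in> carrier G" "y \<in> carrier G" "h \<in> carrier G" and eq: "h \<otimes> x = y \<otimes> h"
  shows "\<phi> x = \<phi> y"
proof (rule eq_of_bounded_on_powers[OF assms(1)])
  fix k :: nat
  have "h \<otimes> x [^] k = y [^] k \<otimes> h"
  proof (induction k)
    case (Suc k)
    have "h \<otimes> x [^] Suc k = (h \<otimes> x [^] k) \<otimes> x" using assms by (simp add: m_assoc)
    also have "\<dots> = y [^] k \<otimes> (h \<otimes> x)" using assms Suc by (simp add: m_assoc)
    also have "\<dots> = y [^] Suc k \<otimes> h" using assms by (simp add: m_assoc)
    finally show ?case .
  qed (use assms in simp)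
  then show "\<bar>\<phi> (x [^] k) - of_nat k * \<phi> y\<bar> \<le> 2 * D"
    using quasi[of h "x [^] k"] quasi[of "y [^] k" h] assms homogeneous[of y k] by auto
qed

lemma commute_add:
  assumes "x \<in> carrier G" "y \<in> carrier G" and comm: "x \<otimes> y = y \<otimes> x"
  shows "\<phi> (x \<otimes> y) = \<phi> x + \<phi> y"
proof (rule eq_of_bounded_on_powers)
  fix k :: nat
  have "(x \<otimes> y) [^] k = x [^] k \<otimes> y [^] k" using assms by (intro pow_mult_distrib)
  then show "\<bar>\<phi> ((x \<otimes> y) [^] k) - of_nat k * (\<phi> x + \<phi> y)\<bar> \<le> D"
    using quasi[of "x [^] k" "y [^] k"] assms by (simp add: homogeneous algebra_simps)
qed (use assms in simp)

lemma inverse_eq: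
  assumes "x \<in> carrier G" "y \<in> carrier G" "x \<otimes> y = \<one>"
  shows "\<phi> y = - \<phi> x"
  using commute_add[OF assms(1,2)] assms inv_comm one_eq_0 by force

text \<open>Moving every \<open>d\<close> to the left writes the \<open>k\<close>-th power of
  \<open>d u\<close> as the \<open>k\<close>-th power of \<open>d\<close> times one element of
  \<open>N\<close>, on which \<open>\<phi>\<close> is bounded. In the application \<open>N\<close>
  is a unipotent radical.\<close>

lemma mult_normalized_eq:
  assumes d: "d \<in> carrier G" and N: "N \<subseteq> carrier G" "\<one> \<in> N"
    and mult: "\<And>u v. \<lbrakk>u \<in> N; v \<in> N\<rbrakk> \<Longrightarrow> u \<otimes> v \<in> N"
    and normal: "\<And>u. u \<in> N \<Longrightarrow> \<exists>v\<in>N. u \<otimes> d = d \<otimes> v"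
    and bound: "\<And>u. u \<in> N \<Longrightarrow> \<bar>\<phi> u\<bar> \<le> C"
    and u: "u \<in> N"
  shows "\<phi> (d \<otimes> u) = \<phi> d"
proof (rule eq_of_bounded_on_powers)
  have uc: "u \<in> carrier G" using u N by blast
  show "d \<otimes> u \<in> carrier G" using d uc by simp
  fix k :: nat
  have "\<exists>v\<in>N. (d \<otimes> u) [^] k = d [^] k \<otimes> v"
  proof (induction k)
    case 0
    then show ?case using N by (intro bexI[of _ \<one>]) auto
  next
    case (Suc k)
    then obtain v where v: "v \<in> N" "(d \<otimes> u) [^] k = d [^] k \<otimes> v" by blast
    obtain v' where v': "v' \<in> N" "v \<otimes> d = d \<otimes> v'" using normal v by blast
    have c: "v \<in> carrier G" "v' \<in> carrier G" using v v' N by auto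
    have "(d \<otimes> u) [^] Suc k = d [^] k \<otimes> (v \<otimes> d) \<otimes> u"
      using d uc c v by (simp add: m_assoc)
    also have "\<dots> = d [^] Suc k \<otimes> (v' \<otimes> u)" using d uc c v' by (simp add: m_assoc)
    finally show ?case using mult v'(1) u by blast
  qed
  then obtain v where "v \<in> N" "(d \<otimes> u) [^] k = d [^] k \<otimes> v" by blast
  then show "\<bar>\<phi> ((d \<otimes> u) [^] k) - of_nat k * \<phi> d\<bar> \<le> D + C"
    using quasi[of "d [^] k" v] bound[of v] N d homogeneous[of d k] by auto
qed

end

section \<open>Matrix algebra and the group EL_n\<close>

lemma mmul_assoc: "mmul n (mmul n X Y) Z = mmul n X (mmul n Y Z)"
proof (intro ext)
  fix i j
  show "mmul n (mmul n X Y) Z i j = mmul n X (mmul n Y Z) i j"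
  proof (cases "i < n \<and> j < n")
    case True
    have "(\<Sum>k<n. (\<Sum>l<n. X i l * Y l k) * Z k j) = (\<Sum>k<n. \<Sum>l<n. X i l * Y l k * Z k j)"
      by (simp add: sum_distrib_right)
    also have "\<dots> = (\<Sum>l<n. \<Sum>k<n. X i l * Y l k * Z k j)" by (rule sum.swap)
    also have "\<dots> = (\<Sum>l<n. X i l * (\<Sum>k<n. Y l k * Z k j))"
      by (simp add: sum_distrib_left mult.assoc)
    finally show ?thesis using True by (simp add: mmul_def)
  qed (auto simp: mmul_def)
qed

lemma mmul_mid_left:
  assumes "\<And>i j. \<not> (i < n \<and> j < n) \<Longrightarrow> X i j = 0"
  shows "mmul n (mid n) X = X"
proof (intro ext)
  fix i j
  show "mmul n (mid n) X i j = X i j"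
    using assms[of i j] by (auto simp: mmul_def mid_def if_distrib[of "\<lambda>x. x * _"] sum.delta cong: if_cong)
qed

text \<open>This holds for arbitrary functions because a product never reads entries outside the
  block. It makes it possible to truncate the loosely specified inverses in
  \<open>commutators\<close>.\<close>

lemma mmul_mid_right_left: "mmul n X (mmul n (mid n) Y) = mmul n X Y"
  unfolding mmul_assoc[symmetric]
  by (intro ext) (auto simp: mmul_def mid_def if_distrib[of "\<lambda>x. _ * x"] sum.delta cong: if_cong intro!: sum.cong)

lemma mmul_mid_right: "mmul n X (mmul n Y (mid n)) = mmul n X Y"
  unfolding mmul_assoc[symmetric]
  by (intro ext) (auto simp: mmul_def mid_def if_distrib[of "\<lambda>x. _ * x"] sum.delta cong: if_cong)

lemma elem_mat_inverse:
  assumes "p < n" "q < n" "p \<noteq> q"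
  shows "mmul n (elem_mat n p q (- c)) (elem_mat n p q c) = mid n"
proof (intro ext)
  fix i j
  have e: "elem_mat n p q x i k = (if i = k then 1 else 0) + (if k = q then if i = p then x else 0 else 0)"
    if "i < n" "k < n" for i k and x :: 'a
    using that assms by (auto simp: elem_mat_def mid_def)
  show "mmul n (elem_mat n p q (- c)) (elem_mat n p q c) i j = mid n i j"
  proof (cases "i < n \<and> j < n")
    case True
    then have "mmul n (elem_mat n p q (- c)) (elem_mat n p q c) i j =
      (\<Sum>k<n. ((if i = k then 1 else 0) + (if k = q then if i = p then - c else 0 else 0))
        * elem_mat n p q c k j)"
      by (auto simp: mmul_def e intro!: sum.cong)
    also have "\<dots> = elem_mat n p q c i j + (if i = p then - c else 0) * elem_mat n p q c q j"
      using True assms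
      by (simp add: distrib_right sum.distrib if_distrib[of "\<lambda>x. x * _"] sum.delta sum.delta' cong: if_cong)
    also have "\<dots> = mid n i j"
      using True assms by (auto simp: elem_mat_def mid_def)
    finally show ?thesis .
  qed (auto simp: mmul_def mid_def)
qed

lemma EL_outside: "g \<in> EL n \<Longrightarrow> \<not> (i < n \<and> j < n) \<Longrightarrow> g i j = 0"
  by (induction rule: EL.induct) (auto simp: mid_def mmul_def)

lemma EL_mid_left: "g \<in> EL n \<Longrightarrow> mmul n (mid n) g = g"
  by (rule mmul_mid_left) (rule EL_outside)

lemma EL_mmul: "g \<in> EL n \<Longrightarrow> h \<in> EL n \<Longrightarrow> mmul n g h \<in> EL n"
  by (induction rule: EL.induct) (auto simp: EL_mid_left mmul_assoc intro: EL.intros)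

lemma mmul_elem_mat_mid:
  assumes "p < n" "q < n" shows "mmul n (elem_mat n p q c) (mid n) = elem_mat n p q c"
  using assms
  by (intro ext) (auto simp: mmul_def mid_def elem_mat_def if_distrib[of "\<lambda>x. _ * x"] sum.delta cong: if_cong)

lemma elem_mat_in_EL:
  assumes "p < n" "q < n" "p \<noteq> q" shows "elem_mat n p q c \<in> EL n"
proof -
  have "elem_mat n p q c \<in> elementary n" using assms by (auto simp: elementary_def)
  from EL_step[OF this EL_id] show ?thesis by (simp add: mmul_elem_mat_mid assms)
qed

text \<open>\<open>EL\<close> is defined as a monoid; cancelling the generators one at a time, each
  by the elementary matrix with negated entry, makes it a group.\<close>

lemma EL_left_inverse: "g \<in> EL n \<Longrightarrow> \<exists>h\<in>EL n. mmul n h g = mid n"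
proof (induction rule: EL.induct)
  case EL_id
  then show ?case using EL_mid_left[OF EL.EL_id] EL.EL_id by blast
next
  case (EL_step e g)
  then obtain h where h: "h \<in> EL n" "mmul n h g = mid n" by blast
  obtain p q c where e: "e = elem_mat n p q c" "p < n" "q < n" "p \<noteq> q"
    using EL_step(1) by (auto simp: elementary_def)
  have "mmul n (elem_mat n p q (- c)) (mmul n e g) = mmul n (mid n) g"
    using elem_mat_inverse[OF e(2-4), of c] by (simp add: e(1) flip: mmul_assoc)
  then have "mmul n (mmul n h (elem_mat n p q (- c))) (mmul n e g) = mid n"
    using EL_mid_left[OF EL_step(2)] h by (simp add: mmul_assoc)
  then show ?case using EL_mmul[OF h(1) elem_mat_in_EL[OF e(2-4)]] by blast
qed

definition EL_group :: "nat \<Rightarrow> 'a::comm_ring_1 mat monoid" where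
  "EL_group n = \<lparr>carrier = EL n, mult = mmul n, one = mid n\<rparr>"

lemma EL_group_simps [simp]:
  "carrier (EL_group n) = EL n" "mult (EL_group n) = mmul n" "one (EL_group n) = mid n"
  by (simp_all add: EL_group_def)

lemma EL_group: "group (EL_group n)"
  by (rule groupI) (auto simp: EL_mmul EL_id mmul_assoc EL_mid_left EL_left_inverse)

section \<open>Block embeddings of EL_k into EL_n\<close>

definition extend :: "nat \<Rightarrow> nat \<Rightarrow> 'a::comm_ring_1 mat \<Rightarrow> 'a mat" where
  "extend k n g = (\<lambda>i j. if i < k \<and> j < k then g i j else mid n i j)"

lemma embed2_eq_extend: "embed2 n = extend 2 n"
  by (simp add: embed2_def extend_def fun_eq_iff)

lemma extend_extend: "k \<le> m \<Longrightarrow> m \<le> n \<Longrightarrow> extend m n (extend k m g) = extend k n g"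
  by (auto simp: extend_def mid_def fun_eq_iff)

lemma extend_mmul:
  assumes "k \<le> n"
  shows "extend k n (mmul k X Y) = mmul n (extend k n X) (extend k n Y)"
proof (intro ext)
  fix i j
  have split: "{..<n} = {..<k} \<union> {k..<n}" using assms by auto
  have "(\<Sum>l<n. extend k n X i l * extend k n Y l j)
      = (\<Sum>l<k. extend k n X i l * extend k n Y l j) + (\<Sum>l\<in>{k..<n}. extend k n X i l * extend k n Y l j)"
    unfolding split by (rule sum.union_disjoint) auto
  also have "(\<Sum>l<k. extend k n X i l * extend k n Y l j)
      = (if i < k \<and> j < k then \<Sum>l<k. X i l * Y l j else 0)"
    by (auto simp: extend_def mid_def intro!: sum.neutral)
  also have "(\<Sum>l\<in>{k..<n}. extend k n X i l * extend k n Y l j)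
      = (\<Sum>l\<in>{k..<n}. if l = i then mid n i j else 0)"
    by (intro sum.cong) (auto simp: extend_def mid_def)
  finally show "extend k n (mmul k X Y) i j = mmul n (extend k n X) (extend k n Y) i j"
    using assms by (auto simp: mmul_def extend_def mid_def sum.delta)
qed

lemma extend_in_EL: "g \<in> EL k \<Longrightarrow> k \<le> n \<Longrightarrow> extend k n g \<in> EL n"
proof (induction rule: EL.induct)
  case EL_id
  then have "extend k n (mid k) = (mid n :: 'a mat)" by (auto simp: extend_def mid_def fun_eq_iff)
  then show ?case by (simp add: EL.EL_id)
next
  case (EL_step e g)
  obtain p q c where e: "e = elem_mat k p q c" "p < k" "q < k" "p \<noteq> q"
    using EL_step(1) by (auto simp: elementary_def)
  then have "extend k n e = elem_mat n p q c"
    using EL_step.prems by (auto simp: extend_def elem_mat_def mid_def fun_eq_iff)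
  then show ?case
    using e EL_step elem_mat_in_EL[of p n q c] by (auto simp: extend_mmul EL_mmul)
qed


section \<open>Explicit 4 x 4 matrices\<close>

text \<open>Listing the entries lets \<open>mmul_mat4\<close> reduce matrix identities to ring
  identities between entries.\<close>

definition mat4 :: "'a list list \<Rightarrow> 'a::comm_ring_1 mat" where
  "mat4 R = (\<lambda>i j. if i < 4 \<and> j < 4 then R ! i ! j else 0)"

lemma less_4_cases: "i < (4::nat) \<longleftrightarrow> i = 0 \<or> i = 1 \<or> i = 2 \<or> i = 3"
  by auto

lemma mat4_eq_iff:
  "mat4 R = X \<longleftrightarrow> (\<forall>i j. \<not> (i < 4 \<and> j < 4) \<longrightarrow> X i j = 0) \<and>
    (\<forall>i\<in>{0,1,2,3}. \<forall>j\<in>{0,1,2,3}. R ! i ! j = X i j)"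
  unfolding mat4_def fun_eq_iff using less_4_cases by auto

lemma mmul_mat4:
  "mmul 4
    (mat4 [[a11, a12, a13, a14], [a21, a22, a23, a24], [a31, a32, a33, a34], [a41, a42, a43, a44]])
    (mat4 [[b11, b12, b13, b14], [b21, b22, b23, b24], [b31, b32, b33, b34], [b41, b42, b43, b44]]) =
   mat4
    [[a11*b11 + a12*b21 + a13*b31 + a14*b41, a11*b12 + a12*b22 + a13*b32 + a14*b42,
      a11*b13 + a12*b23 + a13*b33 + a14*b43, a11*b14 + a12*b24 + a13*b34 + a14*b44],
     [a21*b11 + a22*b21 + a23*b31 + a24*b41, a21*b12 + a22*b22 + a23*b32 + a24*b42,
      a21*b13 + a22*b23 + a23*b33 + a24*b43, a21*b14 + a22*b24 + a23*b34 + a24*b44],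
     [a31*b11 + a32*b21 + a33*b31 + a34*b41, a31*b12 + a32*b22 + a33*b32 + a34*b42,
      a31*b13 + a32*b23 + a33*b33 + a34*b43, a31*b14 + a32*b24 + a33*b34 + a34*b44],
     [a41*b11 + a42*b21 + a43*b31 + a44*b41, a41*b12 + a42*b22 + a43*b32 + a44*b42,
      a41*b13 + a42*b23 + a43*b33 + a44*b43, a41*b14 + a42*b24 + a43*b34 + a44*b44]]"
proof -
  have s: "{..<4::nat} = {0,1,2,3}" by auto
  show ?thesis
    by (rule sym, unfold mat4_eq_iff) (simp add: mmul_def s mat4_def)
qed

lemma mid_4: "mid 4 = mat4 [[1, 0, 0, 0], [0, 1, 0, 0], [0, 0, 1, 0], [0, 0, 0, 1]]"
  by (rule sym, unfold mat4_eq_iff) (auto simp: mid_def)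

lemma elem_mat_4:
  "elem_mat 4 0 1 c = mat4 [[1, c, 0, 0], [0, 1, 0, 0], [0, 0, 1, 0], [0, 0, 0, 1]]"
  "elem_mat 4 0 2 c = mat4 [[1, 0, c, 0], [0, 1, 0, 0], [0, 0, 1, 0], [0, 0, 0, 1]]"
  "elem_mat 4 0 3 c = mat4 [[1, 0, 0, c], [0, 1, 0, 0], [0, 0, 1, 0], [0, 0, 0, 1]]"
  "elem_mat 4 1 0 c = mat4 [[1, 0, 0, 0], [c, 1, 0, 0], [0, 0, 1, 0], [0, 0, 0, 1]]"
  "elem_mat 4 1 2 c = mat4 [[1, 0, 0, 0], [0, 1, c, 0], [0, 0, 1, 0], [0, 0, 0, 1]]"
  "elem_mat 4 1 3 c = mat4 [[1, 0, 0, 0], [0, 1, 0, c], [0, 0, 1, 0], [0, 0, 0, 1]]"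
  "elem_mat 4 2 0 c = mat4 [[1, 0, 0, 0], [0, 1, 0, 0], [c, 0, 1, 0], [0, 0, 0, 1]]"
  "elem_mat 4 2 1 c = mat4 [[1, 0, 0, 0], [0, 1, 0, 0], [0, c, 1, 0], [0, 0, 0, 1]]"
  "elem_mat 4 3 0 c = mat4 [[1, 0, 0, 0], [0, 1, 0, 0], [0, 0, 1, 0], [c, 0, 0, 1]]"
  "elem_mat 4 3 1 c = mat4 [[1, 0, 0, 0], [0, 1, 0, 0], [0, 0, 1, 0], [0, c, 0, 1]]"
  by (rule sym, unfold mat4_eq_iff, force simp: mid_def elem_mat_def)+

abbreviation upper_left :: "'a::comm_ring_1 \<Rightarrow> 'a \<Rightarrow> 'a \<Rightarrow> 'a \<Rightarrow> 'a mat" where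
  "upper_left a b c d \<equiv> mat4 [[a, b, 0, 0], [c, d, 0, 0], [0, 0, 1, 0], [0, 0, 0, 1]]"

abbreviation lower_right :: "'a::comm_ring_1 \<Rightarrow> 'a \<Rightarrow> 'a \<Rightarrow> 'a \<Rightarrow> 'a mat" where
  "lower_right a b c d \<equiv> mat4 [[1, 0, 0, 0], [0, 1, 0, 0], [0, 0, a, b], [0, 0, c, d]]"

text \<open>The unipotent radical of the parabolic with two diagonal blocks of size 2.\<close>

abbreviation block_upper :: "'a::comm_ring_1 \<Rightarrow> 'a \<Rightarrow> 'a \<Rightarrow> 'a \<Rightarrow> 'a mat" where
  "block_upper x y z w \<equiv> mat4 [[1, 0, x, y], [0, 1, z, w], [0, 0, 1, 0], [0, 0, 0, 1]]"

abbreviation block_lower :: "'a::comm_ring_1 \<Rightarrow> 'a \<Rightarrow> 'a \<Rightarrow> 'a \<Rightarrow> 'a mat" where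
  "block_lower x y z w \<equiv> mat4 [[1, 0, 0, 0], [0, 1, 0, 0], [x, y, 1, 0], [z, w, 0, 1]]"

lemma block_upper_in_EL: "block_upper x y z w \<in> EL 4"
proof -
  have "block_upper x y z w =
      mmul 4 (mmul 4 (elem_mat 4 0 2 x) (elem_mat 4 0 3 y)) (mmul 4 (elem_mat 4 1 2 z) (elem_mat 4 1 3 w))"
    by (simp add: elem_mat_4 mmul_mat4 del: One_nat_def)
  then show ?thesis by (simp add: EL_mmul elem_mat_in_EL del: One_nat_def)
qed

lemma block_lower_in_EL: "block_lower x y z w \<in> EL 4"
proof -
  have "block_lower x y z w =
      mmul 4 (mmul 4 (elem_mat 4 2 0 x) (elem_mat 4 2 1 y)) (mmul 4 (elem_mat 4 3 0 z) (elem_mat 4 3 1 w))"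
    by (simp add: elem_mat_4 mmul_mat4 del: One_nat_def)
  then show ?thesis by (simp add: EL_mmul elem_mat_in_EL del: One_nat_def)
qed

lemma upper_left_eq_extend:
  fixes g :: "'a::comm_ring_1 mat"
  shows "extend 2 4 g = upper_left (g 0 0) (g 0 1) (g 1 0) (g 1 1)"
  by (rule sym, unfold mat4_eq_iff) (auto simp: extend_def mid_def)

section \<open>Homogeneous quasi-homomorphisms on EL_4 vanish on SL_2\<close>

locale homogeneous_quasimorphism_EL4 = homogeneous_quasimorphism "EL_group 4" \<phi> D
  for \<phi> :: "'a::comm_ring_1 mat \<Rightarrow> real" and D +
  assumes EL2_eq_SL2: "EL 2 = (SL2 :: 'a mat set)"
begin

text \<open>Here EL_2 = SL_2 turns a determinant condition into membership in EL_4.\<close>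

lemma upper_left_in_EL:
  fixes a b c d :: 'a
  assumes "a * d - b * c = 1" shows "upper_left a b c d \<in> EL 4"
proof -
  define g :: "'a mat" where "g = (\<lambda>i j. if i < 2 \<and> j < 2
    then if i = 0 then if j = 0 then a else b else if j = 0 then c else d else 0)"
  have g: "g \<in> SL2" using assms by (simp add: SL2_def det2_def g_def)
  then have "extend 2 4 g \<in> EL 4" by (intro extend_in_EL) (simp_all add: EL2_eq_SL2)
  then show ?thesis unfolding upper_left_eq_extend by (simp add: g_def)
qed

text \<open>Block version of writing \<open>[[0, 1], [-1, 0]]\<close> as a product of an upper, a
  lower and an upper transvection.\<close>

lemma block_swap_in_EL: "mat4 [[0, 0, 1, 0], [0, 0, 0, 1], [- 1, 0, 0, 0], [0, - 1, 0, 0]] \<in> (EL 4 :: 'a mat set)"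
proof -
  have "mat4 [[0, 0, 1, 0], [0, 0, 0, 1], [- 1, 0, 0, 0], [0, - 1, 0, 0]] =
      mmul 4 (mmul 4 (block_upper 1 0 0 1) (block_lower (- 1) 0 0 (- 1))) (block_upper 1 0 0 (1::'a))"
    by (simp add: mmul_mat4)
  then show ?thesis by (simp add: EL_mmul block_upper_in_EL block_lower_in_EL)
qed

lemma lower_right_conj:
  fixes a b c d :: 'a
  assumes "a * d - b * c = 1"
  shows "lower_right a b c d \<in> EL 4" "\<phi> (lower_right a b c d) = \<phi> (upper_left a b c d)"
proof -
  let ?R = "mat4 [[0, 0, 1, 0], [0, 0, 0, 1], [- 1, 0, 0, 0], [0, - 1, 0, 0]] :: 'a mat"
  \<comment> \<open>The square of \<open>?R\<close> is -1, so its cube is its inverse.\<close>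
  let ?R' = "mmul 4 ?R (mmul 4 ?R ?R)"
  have "lower_right a b c d = mmul 4 (mmul 4 ?R' (upper_left a b c d)) ?R"
    by (simp add: mmul_mat4)
  then show in_EL: "lower_right a b c d \<in> EL 4"
    using upper_left_in_EL[OF assms] block_swap_in_EL by (simp only: EL_mmul)
  show "\<phi> (lower_right a b c d) = \<phi> (upper_left a b c d)"
    using in_EL upper_left_in_EL[OF assms] block_swap_in_EL
    by (intro conj_eq[where h = ?R]) (simp_all add: mmul_mat4)
qed

text \<open>The radical elements are single commutators: with \<open>s\<close> the matrix \<open>[[1, 1], [-1, 0]]\<close>, also
  \<open>s - 1\<close> is invertible, so every block \<open>X\<close> has the form \<open>s Y - Y\<close>.\<close>

lemma unipotent_bound: "\<bar>\<phi> (block_upper x y z w)\<bar> \<le> D"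
proof -
  have S: "upper_left 1 1 (- 1) 0 \<in> (EL 4 :: 'a mat set)" by (rule upper_left_in_EL) simp
  \<comment> \<open>\<open>Y\<close> has rows \<open>(- x - z, - y - w)\<close> and
    \<open>(x, y)\<close>. The values at \<open>s Y\<close> and \<open>- Y\<close> cancel, so only
    one defect remains in the product.\<close>
  have "\<phi> (block_upper (- x - z) (- y - w) x y) = \<phi> (block_upper (- z) (- w) (x + z) (y + w))"
    using S block_upper_in_EL by (intro conj_eq[where h = "upper_left 1 1 (- 1) 0"]) (simp_all add: mmul_mat4 add.commute)
  moreover have "\<phi> (block_upper (x + z) (y + w) (- x) (- y)) = - \<phi> (block_upper (- x - z) (- y - w) x y)"
    using block_upper_in_EL by (intro inverse_eq) (simp_all add: mmul_mat4 mid_4)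
  moreover have "mmul 4 (block_upper (- z) (- w) (x + z) (y + w)) (block_upper (x + z) (y + w) (- x) (- y))
      = block_upper x y z w"
    by (simp add: mmul_mat4)
  ultimately show ?thesis
    using quasi[of "block_upper (- z) (- w) (x + z) (y + w)" "block_upper (x + z) (y + w) (- x) (- y)"]
    by (simp add: block_upper_in_EL)
qed

text \<open>The matrix is its block diagonal part times a radical element. The radical factor is
  invisible to \<open>\<phi>\<close>, and the two diagonal blocks commute.\<close>

lemma block_triangular_eq:
  fixes a b c d a' b' c' d' x y z w :: 'a
  assumes det: "a * d - b * c = 1" "a' * d' - b' * c' = 1"
  shows "mat4 [[a, b, x, y], [c, d, z, w], [0, 0, a', b'], [0, 0, c', d']] \<in> EL 4"
    and "\<phi> (mat4 [[a, b, x, y], [c, d, z, w], [0, 0, a', b'], [0, 0, c', d']])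
      = \<phi> (upper_left a b c d) + \<phi> (upper_left a' b' c' d')"
proof -
  let ?M = "mat4 [[a, b, x, y], [c, d, z, w], [0, 0, a', b'], [0, 0, c', d']]"
  let ?d = "mmul 4 (upper_left a b c d) (lower_right a' b' c' d')"
  \<comment> \<open>With upper blocks \<open>g\<close> and \<open>X\<close>, the radical factor has
    block \<open>g^-1 X\<close>, where \<open>g^-1\<close> is the adjugate. Fact \<open>e\<close>
    below is \<open>g g^-1 = 1\<close> applied to a column.\<close>
  let ?u = "block_upper (d * x - b * z) (d * y - b * w) (a * z - c * x) (a * w - c * y)"
  note UL = upper_left_in_EL[OF det(1)] and LR = lower_right_conj[OF det(2)]
  have e: "a * (d * s - b * t) + b * (a * t - c * s) = s" "c * (d * s - b * t) + d * (a * t - c * s) = t" for s t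
  proof -
    have "a * (d * s - b * t) + b * (a * t - c * s) = (a * d - b * c) * s"
      "c * (d * s - b * t) + d * (a * t - c * s) = (a * d - b * c) * t" by (simp_all add: algebra_simps)
    then show "a * (d * s - b * t) + b * (a * t - c * s) = s" "c * (d * s - b * t) + d * (a * t - c * s) = t"
      using det by simp_all
  qed
  have d_in: "?d \<in> EL 4" using UL LR by (simp only: EL_mmul)
  have M: "?M = mmul 4 ?d ?u"
    using e by (simp add: mmul_mat4)
  show "?M \<in> EL 4" unfolding M using d_in block_upper_in_EL by (rule EL_mmul)
  have "\<phi> (mmul 4 ?d ?u) = \<phi> ?d"
  proof (subst mult_normalized_eq[of ?d "{v. \<exists>x y z w. v = block_upper x y z w}" D ?u, simplified])
    fix v :: "'a mat" assume "\<exists>x y z w. v = block_upper x y z w"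
    then obtain x y z w where v: "v = block_upper x y z w" by blast
    \<comment> \<open>Moving a radical element with block \<open>X\<close> past the diagonal part
      \<open>diag(g, h)\<close> turns \<open>X\<close> into \<open>g^-1 X h\<close>.\<close>
    let ?v = "block_upper (d * (x * a' + y * c') - b * (z * a' + w * c')) (d * (x * b' + y * d') - b * (z * b' + w * d'))
       (a * (z * a' + w * c') - c * (x * a' + y * c')) (a * (z * b' + w * d') - c * (x * b' + y * d'))"
    have "mmul 4 v ?d = mmul 4 ?d ?v"
      unfolding v using e by (simp add: mmul_mat4)
    then show "\<exists>v'. (\<exists>x y z w. v' = block_upper x y z w) \<and> mmul 4 v ?d = mmul 4 ?d v'" by blast
  next
    show "?d \<in> EL 4" by (rule d_in)
  qed (auto simp: block_upper_in_EL mmul_mat4 mid_4 unipotent_bound, intro exI, rule refl)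
  also have "\<dots> = \<phi> (upper_left a b c d) + \<phi> (upper_left a' b' c' d')"
    using commute_add[of "upper_left a b c d" "lower_right a' b' c' d'"] UL LR
    by (simp add: mmul_mat4)
  finally show "\<phi> ?M = \<phi> (upper_left a b c d) + \<phi> (upper_left a' b' c' d')" unfolding M .
qed

lemma middle_swap_in_EL:
  "mat4 [[1, 0, 0, 0], [0, 0, 1, 0], [0, - 1, 0, 0], [0, 0, 0, 1]] \<in> (EL 4 :: 'a mat set)"
proof -
  have "mat4 [[1, 0, 0, 0], [0, 0, 1, 0], [0, - 1, 0, 0], [0, 0, 0, 1]] =
      mmul 4 (mmul 4 (elem_mat 4 1 2 1) (elem_mat 4 2 1 (- 1))) (elem_mat 4 1 2 (1::'a))"
    by (simp add: elem_mat_4 mmul_mat4 del: One_nat_def)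
  then show ?thesis by (simp add: EL_mmul elem_mat_in_EL del: One_nat_def)
qed

text \<open>A sign change takes \<open>?C\<close> to \<open>?C'\<close>, and \<open>?J\<close>
  conjugates the inverse \<open>?C''\<close> of \<open>?C'\<close> to \<open>?C\<close>. Thus the
  value at \<open>?C\<close> equals its own negative.\<close>

lemma companion_eq_0:
  shows "\<phi> (upper_left 0 1 (- 1) \<tau>) = 0" "\<phi> (upper_left 0 (- 1) 1 \<tau>) = 0"
proof -
  let ?C = "upper_left 0 1 (- 1) \<tau>" and ?C' = "upper_left 0 (- 1) 1 \<tau>" and ?C'' = "upper_left \<tau> 1 (- 1) 0"
  let ?J = "upper_left 0 1 (- 1) 0 :: 'a mat"
  have in_EL: "?C \<in> EL 4" "?C' \<in> EL 4" "?C'' \<in> EL 4" "?J \<in> EL 4"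
    by (simp_all add: upper_left_in_EL)
  let ?w = "mat4 [[1, 0, 0, 0], [0, 0, 1, 0], [0, - 1, 0, 0], [0, 0, 0, 1]] :: 'a mat"
  \<comment> \<open>This square is \<open>diag(1, -1, -1, 1)\<close>: the sign change
    \<open>diag(1, -1)\<close> has determinant -1, compensated in the third coordinate, where the
    companion matrices are trivial.\<close>
  have "mmul 4 ?w ?w \<in> EL 4" by (intro EL_mmul middle_swap_in_EL)
  then have "\<phi> ?C = \<phi> ?C'"
    using in_EL by (intro conj_eq[where h = "mmul 4 ?w ?w"]) (simp_all add: mmul_mat4)
  moreover have "\<phi> ?C'' = - \<phi> ?C'"
    using in_EL by (intro inverse_eq) (simp_all add: mmul_mat4 mid_4)
  moreover have "\<phi> ?C'' = \<phi> ?C"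
    using in_EL by (intro conj_eq[where h = ?J]) (simp_all add: mmul_mat4)
  ultimately show "\<phi> ?C = 0" "\<phi> ?C' = 0" by linarith+
qed

text \<open>With \<open>s\<close> the upper transvection by \<open>t\<close>, the two block
  triangular forms yield \<open>\<phi>(g s) + \<phi>(g^-1) = 0\<close>.\<close>

lemma mult_right_transvection:
  fixes a b c d t :: 'a
  assumes det: "a * d - b * c = 1"
  shows "\<phi> (upper_left a (t * a + b) c (t * c + d)) = \<phi> (upper_left a b c d)"
proof -
  let ?A = a and ?B = "t * a + b" and ?C = c and ?D = "t * c + d"
  let ?M = "mat4 [[?A, ?B, 1, 0], [?C, ?D, 0, 1], [0, 0, d, - b], [0, 0, - c, a]]"
  \<comment> \<open>By Cayley-Hamilton \<open>g s + g^-1\<close> is \<open>tr(g)\<close> plus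
    \<open>g (s - 1)\<close>, whose first column is zero; hence the lower left block vanishes. The
    diagonal blocks have traces \<open>tr(g)\<close> and \<open>tr(g s)\<close>, and the signs in
    the second come from the -1 in \<open>?w\<close>.\<close>
  let ?M' = "mat4 [[0, 1, 0, 0], [- 1, a + d, t, t * a], [0, 0, 0, - 1], [0, 0, 1, a + d + t * c]]"
  let ?w = "mat4 [[1, 0, 0, 0], [0, 0, 1, 0], [0, - 1, 0, 0], [0, 0, 0, 1]] :: 'a mat"
  \<comment> \<open>Conjugation by the second factor produces the block companion matrix; the first one
    exchanges the two middle coordinates, which makes it block triangular.\<close>
  let ?W = "mmul 4 ?w (block_lower ?A ?B ?C ?D)"
  have det1: "?A * ?D - ?B * ?C = 1" and det2: "d * a - - b * - c = 1"
    using det by (simp_all add: algebra_simps)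
  have W: "?W \<in> EL 4" using middle_swap_in_EL block_lower_in_EL by (rule EL_mmul)
  have bc: "b * c = a * d - 1" using det by (simp add: algebra_simps)
  \<comment> \<open>Normalization nests products to the right, so the determinant relation is also
    needed in this shape.\<close>
  have bcx: "b * (c * x) = a * (d * x) - x" for x
    unfolding mult.assoc[symmetric] bc by (simp add: left_diff_distrib)
  have "mmul 4 ?W ?M = mmul 4 ?M' ?W"
    by (simp add: mmul_mat4 algebra_simps bc bcx)
  moreover have "?M \<in> EL 4" "?M' \<in> EL 4"
    using det1 det2 by (auto intro!: block_triangular_eq(1))
  ultimately have "\<phi> ?M = \<phi> ?M'" using W by (intro conj_eq[where h = ?W]) simp_all
  moreover have "\<phi> ?M = \<phi> (upper_left ?A ?B ?C ?D) + \<phi> (upper_left d (- b) (- c) a)"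
    using det1 det2 by (rule block_triangular_eq(2))
  moreover have "\<phi> ?M' = \<phi> (upper_left 0 1 (- 1) (a + d)) + \<phi> (upper_left 0 (- 1) 1 (a + d + t * c))"
    by (rule block_triangular_eq(2)) simp_all
  moreover have "\<phi> (upper_left d (- b) (- c) a) = - \<phi> (upper_left a b c d)"
    using det det2 upper_left_in_EL[OF det] upper_left_in_EL[OF det2]
    by (intro inverse_eq) (simp_all add: mmul_mat4 mid_4 algebra_simps)
  ultimately show ?thesis using companion_eq_0 by simp
qed

text \<open>Conjugation by \<open>[[0, 1], [-1, 0]]\<close> is the inverse transpose on SL_2; it
  exchanges lower and upper transvections and replaces \<open>t\<close> by
  \<open>- t\<close>.\<close>

lemma mult_right_lower_transvection:
  fixes a b c d t :: 'a
  assumes det: "a * d - b * c = 1"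
  shows "\<phi> (upper_left (a + t * b) b (c + t * d) d) = \<phi> (upper_left a b c d)"
proof -
  have rotate: "\<phi> (upper_left p q r s) = \<phi> (upper_left s (- r) (- q) p)" if det: "p * s - q * r = 1" for p q r s :: 'a
  proof (rule conj_eq[where h = "upper_left 0 1 (- 1) 0"])
    have "s * p - (- r) * (- q) = 1" using det by (simp add: algebra_simps)
    then show "upper_left s (- r) (- q) p \<in> carrier (EL_group 4)" using upper_left_in_EL by simp
  qed (use upper_left_in_EL det in \<open>simp_all add: mmul_mat4\<close>)
  have "\<phi> (upper_left (a + t * b) b (c + t * d) d) = \<phi> (upper_left d (- t * d + - c) (- b) (- t * - b + a))"
    using det by (subst rotate) (simp_all add: algebra_simps)
  also have "\<dots> = \<phi> (upper_left d (- c) (- b) a)"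
    using det by (intro mult_right_transvection) (simp add: algebra_simps)
  also have "\<dots> = \<phi> (upper_left a b c d)" using rotate[OF det] by simp
  finally show ?thesis .
qed

lemma vanishes_on_SL2:
  "g \<in> EL 2 \<Longrightarrow> \<phi> (extend 2 4 g) = 0"
proof (induction rule: EL.induct)
  case EL_id
  have "extend 2 4 (mid 2) = (mid 4 :: 'a mat)" by (auto simp: extend_def mid_def fun_eq_iff)
  then show ?case using one_eq_0 by simp
next
  case (EL_step e g)
  let ?a = "g 0 0" and ?b = "g 0 1" and ?c = "g 1 0" and ?d = "g 1 1"
  obtain p q t where e: "e = elem_mat 2 p q t" "p < 2" "q < 2" "p \<noteq> q"
    using EL_step(1) by (auto simp: elementary_def)
  have det: "?a * ?d - ?b * ?c = 1"
    using EL_step(2) by (simp add: EL2_eq_SL2 SL2_def det2_def)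
  have in_EL: "extend 2 4 e \<in> EL 4" "extend 2 4 g \<in> EL 4"
    using elem_mat_in_EL[OF e(2-4), of t] EL_step(2) unfolding e(1) by (simp_all add: extend_in_EL)
  have e4: "extend 2 4 e = elem_mat 4 p q t"
    unfolding e(1) using e(2-4) by (auto simp: extend_def elem_mat_def mid_def fun_eq_iff)
  \<comment> \<open>\<open>EL\<close> grows by left multiplication while the transvection lemmas act
    on the right; \<open>e g\<close> and \<open>g e\<close> are conjugate by
    \<open>e\<close>.\<close>
  have "\<phi> (extend 2 4 (mmul 2 e g)) = \<phi> (mmul 4 (extend 2 4 g) (extend 2 4 e))"
    using in_EL by (intro conj_eq[symmetric, where h = "extend 2 4 e"]) (simp_all add: extend_mmul EL_mmul mmul_assoc)
  also have "\<dots> = \<phi> (extend 2 4 g)"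
  proof -
    have "p = 0 \<and> q = 1 \<or> p = 1 \<and> q = 0" using e(2-4) by auto
    then show ?thesis
      using mult_right_transvection[OF det, of t] mult_right_lower_transvection[OF det, of t]
      unfolding e4 by (auto simp: upper_left_eq_extend elem_mat_4 mmul_mat4 algebra_simps simp del: One_nat_def)
  qed
  also have "\<dots> = 0" by (rule EL_step.IH)
  finally show ?case .
qed

end

section \<open>Bounding the quasi-homomorphism on EL_n\<close>

lemma EL_group_quasimorphism:
  assumes "quasi_hom n (EL n) \<psi>"
  obtains D where "quasimorphism (EL_group n) \<psi> D"
proof -
  obtain D where "\<forall>g\<in>EL n. \<forall>h\<in>EL n. \<bar>\<psi> (mmul n g h) - \<psi> g - \<psi> h\<bar> \<le> D"
    using assms unfolding quasi_hom_def by blast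
  then have "quasimorphism (EL_group n) \<psi> D"
    by (simp add: quasimorphism_def quasimorphism_axioms_def EL_group)
  then show thesis by (rule that)
qed

text \<open>The bound is the distance from the restriction of \<open>\<psi>\<close> to EL_4 to its
  homogenization, which vanishes on SL_2.\<close>

lemma quasi_hom_bounded_on_SL2:
  fixes \<psi> :: "'a::comm_ring_1 mat \<Rightarrow> real"
  assumes n: "4 \<le> n" and EL2: "EL 2 = (SL2 :: 'a mat set)"
    and q: "quasimorphism (EL_group n) \<psi> D" and g: "g \<in> SL2"
  shows "\<bar>\<psi> (embed2 n g)\<bar> \<le> D"
proof -
  interpret quasimorphism "EL_group n" \<psi> D by (rule q)
  interpret restr: quasimorphism "EL_group 4" "\<lambda>x. \<psi> (extend 4 n x)" D
    unfolding quasimorphism_def quasimorphism_axioms_def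
    using quasi n by (auto simp: EL_group extend_mmul extend_in_EL)
  obtain \<phi> where "homogeneous_quasimorphism (EL_group 4) \<phi> (4 * D)"
    and near: "\<And>x. x \<in> carrier (EL_group 4) \<Longrightarrow> \<bar>\<phi> x - \<psi> (extend 4 n x)\<bar> \<le> D"
    using restr.homogenization by blast
  then interpret homogeneous_quasimorphism_EL4 \<phi> "4 * D"
    by (simp add: homogeneous_quasimorphism_EL4_def homogeneous_quasimorphism_EL4_axioms_def EL2)
  have g2: "g \<in> EL 2" using g EL2 by simp
  have "\<phi> (extend 2 4 g) = 0" by (rule vanishes_on_SL2[OF g2])
  moreover have "extend 4 n (extend 2 4 g) = embed2 n g"
    using n by (simp add: embed2_eq_extend extend_extend)
  ultimately show ?thesis using near[of "extend 2 4 g"] extend_in_EL[OF g2, of 4] by simp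
qed

text \<open>\<open>is_inverse n a a'\<close> leaves the entries of \<open>a'\<close> outside the \<open>n \<times> n\<close> block unconstrained, so
  \<open>a'\<close> itself need not lie in \<open>EL n\<close>.\<close>

lemma is_inverse_restrict:
  assumes "a \<in> EL n" "is_inverse n a a'"
  shows "mmul n a' (mid n) \<in> EL n"
proof -
  obtain h where h: "h \<in> EL n" "mmul n h a = mid n" using EL_left_inverse assms(1) by blast
  have "mmul n h (mmul n a a') = mmul n (mmul n h a) a'" by (simp add: mmul_assoc)
  then have "mmul n h (mid n) = mmul n (mid n) a'" using h assms(2) by (simp add: is_inverse_def)
  moreover have "mmul n (mmul n (mid n) a') (mid n) = mmul n a' (mid n)"
    by (intro ext) (simp add: mmul_def mid_def if_distrib[of "\<lambda>x. x * _"] if_distrib[of "\<lambda>x. _ * x"] sum.delta sum.delta' cong: if_cong)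
  ultimately show ?thesis using h(1) EL_mmul EL_id by metis
qed

text \<open>A commutator \<open>c\<close> of \<open>a\<close> and \<open>b\<close> satisfies
  \<open>c (b a) = a b\<close>. Expanding both sides costs three defects, and the values at
  \<open>a\<close> and \<open>b\<close> cancel.\<close>

lemma quasi_hom_bounded_on_commutators:
  assumes q: "quasimorphism (EL_group n) \<psi> D" and c: "c \<in> commutators n (EL n)"
  shows "c \<in> EL n" "\<bar>\<psi> c\<bar> \<le> 3 * D"
proof -
  interpret quasimorphism "EL_group n" \<psi> D by (rule q)
  obtain a b a' b' where c_eq: "c = mmul n (mmul n (mmul n a b) a') b'"
    and ab: "a \<in> EL n" "b \<in> EL n" "is_inverse n a a'" "is_inverse n b b'"
    using c unfolding commutators_def by blast
  \<comment> \<open>Truncating \<open>a'\<close> and \<open>b'\<close> to the block leaves the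
    product unchanged and puts every factor in \<open>EL n\<close>.\<close>
  have "c = mmul n (mmul n (mmul n a b) (mmul n a' (mid n))) (mmul n b' (mid n))"
    unfolding c_eq by (simp add: mmul_assoc mmul_mid_right mmul_mid_right_left)
  then show c_in: "c \<in> EL n"
    using ab is_inverse_restrict EL_mmul by metis
  have "mmul n c (mmul n b a) = mmul n (mmul n (mmul n a b) a') (mmul n (mmul n b' b) a)"
    by (simp add: c_eq mmul_assoc)
  also have "\<dots> = mmul n (mmul n a b) (mmul n a' a)"
    using ab by (simp add: is_inverse_def EL_mid_left mmul_assoc)
  also have "\<dots> = mmul n a b"
    using r_one[of "mmul n a b"] ab by (simp add: is_inverse_def EL_mmul)
  finally have "mmul n c (mmul n b a) = mmul n a b" .
  then show "\<bar>\<psi> c\<bar> \<le> 3 * D"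
    using quasi[of c "mmul n b a"] quasi[of a b] quasi[of b a] ab c_in by (simp add: EL_mmul)
qed

text \<open>Every factor adds its own bound \<open>B\<close> and one defect; the list ends in the
  identity, whose value need not be 0.\<close>

lemma mprod_bound:
  assumes q: "quasimorphism (EL_group n) \<psi> D"
    and "\<And>x. x \<in> set xs \<Longrightarrow> x \<in> EL n \<and> \<bar>\<psi> x\<bar> \<le> B"
  shows "mprod n xs \<in> EL n \<and> \<bar>\<psi> (mprod n xs)\<bar> \<le> \<bar>\<psi> (mid n)\<bar> + real (length xs) * (B + D)"
  using assms(2)
proof (induction xs)
  case Nil
  then show ?case by (simp add: mprod_def EL_id)
next
  case (Cons x xs)
  interpret quasimorphism "EL_group n" \<psi> D by (rule q)
  have IH: "mprod n xs \<in> EL n" "\<bar>\<psi> (mprod n xs)\<bar> \<le> \<bar>\<psi> (mid n)\<bar> + real (length xs) * (B + D)"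
    and x: "x \<in> EL n" "\<bar>\<psi> x\<bar> \<le> B"
    using Cons by auto
  have eq: "mprod n (x # xs) = mmul n x (mprod n xs)" by (simp add: mprod_def)
  show ?case
    unfolding eq using quasi[of x "mprod n xs"] IH x by (auto simp: EL_mmul algebra_simps)
qed

theorem theorem1p3:
  fixes n :: nat and \<psi> :: "'a::comm_ring_1 mat \<Rightarrow> real"
  assumes "6 \<le> n"
    and "EL 2 = (SL2 :: 'a mat set)"
    and "\<exists>M::nat. \<forall>g\<in>(EL n :: 'a mat set). \<exists>xs. length xs = M \<and>
            (\<forall>x\<in>set xs. x \<in> embed2 n ` SL2 \<or> x \<in> commutators n (EL n)) \<and>
            g = mprod n xs"
    and "quasi_hom n (EL n) \<psi>"
  shows "\<exists>C. \<forall>g\<in>EL n. \<bar>\<psi> g\<bar> \<le> C"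
proof -
  obtain D where q: "quasimorphism (EL_group n) \<psi> D"
    using EL_group_quasimorphism assms(4) by blast
  obtain M where M: "\<forall>g\<in>(EL n :: 'a mat set). \<exists>xs. length xs = M \<and>
      (\<forall>x\<in>set xs. x \<in> embed2 n ` SL2 \<or> x \<in> commutators n (EL n)) \<and> g = mprod n xs"
    using assms(3) by blast
  have D: "0 \<le> D" using q by (rule quasimorphism.defect_nonneg)
  \<comment> \<open>SL_2 factors contribute at most \<open>D\<close> and commutators at most
    \<open>3 * D\<close>; the larger bound serves both because \<open>D\<close> is
    nonnegative.\<close>
  have factor: "x \<in> EL n \<and> \<bar>\<psi> x\<bar> \<le> 3 * D" if "x \<in> embed2 n ` SL2 \<or> x \<in> commutators n (EL n)" for x
    using that
  proof
    assume "x \<in> embed2 n ` SL2"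
    then obtain g where g: "x = embed2 n g" "g \<in> SL2" by blast
    have "\<bar>\<psi> x\<bar> \<le> D" unfolding g(1) using assms(1) g(2) by (intro quasi_hom_bounded_on_SL2 assms(2) q) auto
    moreover have "x \<in> EL n"
      unfolding g(1) embed2_eq_extend using assms(1,2) g(2) by (intro extend_in_EL) auto
    ultimately show ?thesis using D by simp
  qed (use quasi_hom_bounded_on_commutators[OF q] in blast)
  show ?thesis
  proof (intro exI ballI)
    fix g :: "'a mat" assume "g \<in> EL n"
    then obtain xs where xs: "length xs = M" "g = mprod n xs"
      "\<forall>x\<in>set xs. x \<in> embed2 n ` SL2 \<or> x \<in> commutators n (EL n)" using M by blast
    show "\<bar>\<psi> g\<bar> \<le> \<bar>\<psi> (mid n)\<bar> + real M * (3 * D + D)"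
      using mprod_bound[OF q, of xs "3 * D"] factor xs by blast
  qed
qed

end
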